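(* Let $h\geq2$ and $a\geq1$ be integers. If $\mathcal{S}_{2h}(a)$ is integral, then $h\in\{2,3\}$, that is, the cycle of $\mathcal{S}_{2h}(a)$ is either a square or a hexagon.
   Context: A graph is integral if all eigenvalues of its adjacency matrix are integers. For integers $h\geq2$ and $a\geq1$, $\mathcal{S}_{2h}(a)$ is the graph obtained from the cycle $C_{2h}=v_1v_2\cdots v_{2h}v_1$ by attaching no pendant vertex to $v_1$, exactly $2a$ pendant vertices to the antipodal vertex $v_{h+1}$, and exactly $a$ pendant vertices to each of the remaining $2h-2$ cycle vertices. *)

theory Defs
  imports Graph_Theory.Pair_Digraph Jordan_Normal_Form.Char_Poly
begin

text \<open>Finite simple graphs are the symmetric loop-free finite digraphs of the locale
  \<^locale>\<open>pair_graph\<close>: an edge is represented by its two opposite arcs.\<close>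

definition adjacency_matrix :: "'v pair_pre_digraph \<Rightarrow> 'v list \<Rightarrow> 'a :: {zero, one} mat" where
  "adjacency_matrix G vs =
     mat (length vs) (length vs) (\<lambda>(i, j). if (vs ! i, vs ! j) \<in> parcs G then 1 else 0)"

text \<open>The matrix is taken over the complex numbers, so that no eigenvalue is
  excluded a priori. The spectrum does not depend on the enumeration \<open>vs\<close> of the vertices,
  see \<open>integral_graph_iff\<close> below.\<close>

definition integral_graph :: "'v pair_pre_digraph \<Rightarrow> bool" where
  "integral_graph G \<longleftrightarrow>
     (\<exists>vs. distinct vs \<and> set vs = pverts G \<and>
       (\<forall>k :: complex. eigenvalue (adjacency_matrix G vs) k \<longrightarrow> k \<in> \<int>))"

lemma eigenvalue_adjacency_matrix_iff:
  fixes k :: "'a :: comm_ring_1"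
  assumes d: "distinct vs" and V: "set vs = pverts G"
  shows "eigenvalue (adjacency_matrix G vs) k \<longleftrightarrow>
    (\<exists>f. (\<exists>x\<in>pverts G. f x \<noteq> 0) \<and>
         (\<forall>x\<in>pverts G. (\<Sum>y | y \<in> pverts G \<and> (x, y) \<in> parcs G. f y) = k * f x))"
proof -
  let ?n = "length vs"
  let ?A = "adjacency_matrix G vs :: 'a mat"
  have bij: "bij_betw (\<lambda>i. vs ! i) {0..<?n} (pverts G)"
    using d V by (metis atLeast0LessThan bij_betw_nth)
  have nth_in: "vs ! i \<in> pverts G" if "i < ?n" for i
    using that V nth_mem by blast
  have fin: "finite (pverts G)" using V by (metis List.finite_set)
  have dim: "dim_row ?A = ?n" "dim_col ?A = ?n"
    by (auto simp: adjacency_matrix_def)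
  have mult: "(?A *\<^sub>v vec ?n (\<lambda>i. f (vs ! i))) $ i =
      (\<Sum>y | y \<in> pverts G \<and> (vs ! i, y) \<in> parcs G. f y)" if i: "i < ?n" for f i
  proof -
    have "(?A *\<^sub>v vec ?n (\<lambda>i. f (vs ! i))) $ i =
        (\<Sum>j = 0..<?n. if (vs ! i, vs ! j) \<in> parcs G then f (vs ! j) else 0)"
      using i by (auto simp: adjacency_matrix_def scalar_prod_def intro!: sum.cong)
    also have "\<dots> = (\<Sum>y\<in>pverts G. if (vs ! i, y) \<in> parcs G then f y else 0)"
      by (rule sum.reindex_bij_betw[OF bij])
    also have "\<dots> = (\<Sum>y | y \<in> pverts G \<and> (vs ! i, y) \<in> parcs G. f y)"
      using fin by (simp add: sum.inter_filter[symmetric])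
    finally show ?thesis .
  qed
  have key: "eigenvector ?A (vec ?n (\<lambda>i. f (vs ! i))) k \<longleftrightarrow>
      (\<exists>x\<in>pverts G. f x \<noteq> 0) \<and>
      (\<forall>x\<in>pverts G. (\<Sum>y | y \<in> pverts G \<and> (x, y) \<in> parcs G. f y) = k * f x)" for f
  proof -
    have nz: "vec ?n (\<lambda>i. f (vs ! i)) \<noteq> 0\<^sub>v ?n \<longleftrightarrow> (\<exists>x\<in>pverts G. f x \<noteq> 0)"
      unfolding V[symmetric] by (auto simp: vec_eq_iff set_conv_nth)
    have "?A *\<^sub>v vec ?n (\<lambda>i. f (vs ! i)) = k \<cdot>\<^sub>v vec ?n (\<lambda>i. f (vs ! i)) \<longleftrightarrow>
        (\<forall>i<?n. (?A *\<^sub>v vec ?n (\<lambda>i. f (vs ! i))) $ i = k * f (vs ! i))"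
      by (auto simp: vec_eq_iff dim)
    also have "\<dots> \<longleftrightarrow> (\<forall>i<?n. (\<Sum>y | y \<in> pverts G \<and> (vs ! i, y) \<in> parcs G. f y) = k * f (vs ! i))"
      using mult by auto
    also have "\<dots> \<longleftrightarrow>
        (\<forall>x\<in>pverts G. (\<Sum>y | y \<in> pverts G \<and> (x, y) \<in> parcs G. f y) = k * f x)"
      unfolding V[symmetric] all_set_conv_all_nth ..
    finally show ?thesis using nz by (simp add: eigenvector_def dim)
  qed
  have ex: "\<exists>f. v = vec ?n (\<lambda>i. f (vs ! i))" if "v \<in> carrier_vec ?n" for v :: "'a vec"
  proof
    show "v = vec ?n (\<lambda>i. v $ the_inv_into {0..<?n} (\<lambda>i. vs ! i) (vs ! i))"
      using that bij by (auto simp: vec_eq_iff bij_betw_def the_inv_into_f_f)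
  qed
  show ?thesis
  proof
    assume "eigenvalue ?A k"
    then obtain v where v: "eigenvector ?A v k" unfolding eigenvalue_def ..
    then have "v \<in> carrier_vec ?n" by (simp add: eigenvector_def dim)
    then obtain f where "v = vec ?n (\<lambda>i. f (vs ! i))" using ex by blast
    then show "\<exists>f. (\<exists>x\<in>pverts G. f x \<noteq> 0) \<and>
         (\<forall>x\<in>pverts G. (\<Sum>y | y \<in> pverts G \<and> (x, y) \<in> parcs G. f y) = k * f x)"
      using v key by blast
  next
    assume "\<exists>f. (\<exists>x\<in>pverts G. f x \<noteq> 0) \<and>
         (\<forall>x\<in>pverts G. (\<Sum>y | y \<in> pverts G \<and> (x, y) \<in> parcs G. f y) = k * f x)"
    then show "eigenvalue ?A k" using key unfolding eigenvalue_def by blast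
  qed
qed

lemma integral_graph_iff:
  assumes "distinct vs" and "set vs = pverts G"
  shows "integral_graph G \<longleftrightarrow>
    (\<forall>k :: complex. eigenvalue (adjacency_matrix G vs) k \<longrightarrow> k \<in> \<int>)"
proof
  assume "integral_graph G"
  then obtain ws where ws: "distinct ws" "set ws = pverts G"
    and int: "\<And>k :: complex. eigenvalue (adjacency_matrix G ws) k \<Longrightarrow> k \<in> \<int>"
    unfolding integral_graph_def by blast
  show "\<forall>k :: complex. eigenvalue (adjacency_matrix G vs) k \<longrightarrow> k \<in> \<int>"
    using int unfolding eigenvalue_adjacency_matrix_iff[OF ws] eigenvalue_adjacency_matrix_iff[OF assms]
    by blast
next
  assume "\<forall>k :: complex. eigenvalue (adjacency_matrix G vs) k \<longrightarrow> k \<in> \<int>"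
  then show "integral_graph G" using assms unfolding integral_graph_def by blast
qed

text \<open>\<open>Cyc i\<close> is the cycle vertex $v_i$, where \<open>1 \<le> i \<le> 2 * h\<close>, and \<open>Pend i j\<close> is the
  \<open>j\<close>-th pendant vertex attached to it, counted from 1.\<close>

datatype vertex = Cyc nat | Pend nat nat

definition pendant_count :: "nat \<Rightarrow> nat \<Rightarrow> nat \<Rightarrow> nat" where
  "pendant_count h a i = (if i = 1 then 0 else if i = h + 1 then 2 * a else a)"

definition S_arcs :: "nat \<Rightarrow> nat \<Rightarrow> vertex rel" where
  "S_arcs h a =
     {(Cyc i, Cyc (i + 1)) | i. 1 \<le> i \<and> i < 2 * h} \<union> {(Cyc (2 * h), Cyc 1)} \<union>
     {(Cyc i, Pend i j) | i j. 1 \<le> i \<and> i \<le> 2 * h \<and> 1 \<le> j \<and> j \<le> pendant_count h a i}"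

definition S_graph :: "nat \<Rightarrow> nat \<Rightarrow> vertex pair_pre_digraph" where
  "S_graph h a = \<lparr>
     pverts = {Cyc i | i. 1 \<le> i \<and> i \<le> 2 * h} \<union>
       {Pend i j | i j. 1 \<le> i \<and> i \<le> 2 * h \<and> 1 \<le> j \<and> j \<le> pendant_count h a i},
     parcs = S_arcs h a \<union> (S_arcs h a)\<inverse> \<rparr>"

lemma pair_graph_S_graph:
  assumes "h \<ge> 1"
  shows "pair_graph (S_graph h a)"
proof -
  have "pverts (S_graph h a) \<subseteq> Cyc ` {..2 * h} \<union>
      (\<lambda>(i, j). Pend i j) ` ({..2 * h} \<times> {..2 * a})"
    by (auto simp: S_graph_def pendant_count_def split: if_splits)
  then have fin: "finite (pverts (S_graph h a))"
    by (rule finite_subset) auto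
  have wf: "parcs (S_graph h a) \<subseteq> pverts (S_graph h a) \<times> pverts (S_graph h a)"
    using assms by (auto simp: S_graph_def S_arcs_def)
  have fin': "finite (parcs (S_graph h a))"
    using finite_subset[OF wf] fin by blast
  have loopfree: "fst e \<noteq> snd e" if "e \<in> parcs (S_graph h a)" for e
    using that assms by (auto simp: S_graph_def S_arcs_def)
  have "sym (parcs (S_graph h a))"
    by (auto simp: S_graph_def sym_def)
  then have symm: "symmetric (with_proj (S_graph h a))"
    by (simp add: symmetric_def)
  show ?thesis
    by unfold_locales (use wf fin fin' loopfree symm in auto)
qed

end

theory Submission
  imports Defs
begin

text \<open>The eigenvectors that are antisymmetric about the axis through $v_1$ and $v_{h+1}$ vanish at
  these two vertices, so they see only the \<open>a\<close> pendant vertices at each other cycle vertex. Taking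
  $\sin(\pi (i - 1) / h)$ at $v_i$ shows that both roots of
  $\lambda^2 - 2 \cos(\pi / h) \lambda - a$ are eigenvalues. If they are integers, then so is their
  sum $2 \cos(\pi / h)$, which lies strictly between 1 and 2 when $h \ge 4$.\<close>

lemma neighbours_Cyc:
  assumes "i \<in> {1..2 * h}"
  shows "{y. y \<in> pverts (S_graph h a) \<and> (Cyc i, y) \<in> parcs (S_graph h a)} =
    {Cyc (if i = 2 * h then 1 else i + 1), Cyc (if i = 1 then 2 * h else i - 1)} \<union>
    Pend i ` {1..pendant_count h a i}"
    (is "?L = ?R")
proof (rule Set.set_eqI)
  fix y
  show "y \<in> ?L \<longleftrightarrow> y \<in> ?R"
  proof (cases y)
    case (Cyc m)
    then show ?thesis using assms by (auto simp: S_graph_def S_arcs_def)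
  next
    case (Pend m j)
    then show ?thesis using assms by (auto simp: S_graph_def S_arcs_def)
  qed
qed

lemma neighbours_Pend:
  assumes "Pend i j \<in> pverts (S_graph h a)"
  shows "{y. y \<in> pverts (S_graph h a) \<and> (Pend i j, y) \<in> parcs (S_graph h a)} = {Cyc i}"
  using assms by (auto simp: S_graph_def S_arcs_def)

text \<open>The eigenvector is the sine wave of frequency \<open>k\<close> along the cycle, extended
  to the pendant vertices. Once the pendant values are eliminated, every cycle equation becomes a
  multiple of the quadratic relation \<open>l\<close>.\<close>

lemma eigenvalue_S_graph:
  fixes l :: complex and h k a :: nat
  assumes h: "h \<ge> 2" and k: "0 < k" "k < h" and l0: "l \<noteq> 0"
    and l: "l\<^sup>2 = of_real (2 * cos (pi * k / h)) * l + of_nat a"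
    and V: "distinct vs" "set vs = pverts (S_graph h a)"
  shows "eigenvalue (adjacency_matrix (S_graph h a) vs) l"
proof -
  let ?G = "S_graph h a"
  define \<theta> where "\<theta> = pi * k / h"
  \<comment> \<open>The shift by 1 puts one zero of the wave at \<open>Cyc 1\<close>; the antipode
    \<open>Cyc (h + 1)\<close> has phase \<open>pi * k\<close>, so it is a zero as well.\<close>
  define s where "s = (\<lambda>i :: nat. sin (\<theta> * (real i - 1)))"
  \<comment> \<open>The equation at a leaf reads \<open>f (Cyc i) = l * f (Pend i j)\<close>, which
    forces the division by \<open>l\<close>.\<close>
  define f where "f = case_vertex (\<lambda>i. of_real (s i)) (\<lambda>i j. of_real (s i) / l)"
  have f_Cyc: "f (Cyc i) = of_real (s i)" and f_Pend: "f (Pend i j) = of_real (s i) / l" for i j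
    by (simp_all add: f_def)
  have s1: "s 1 = 0" by (simp add: s_def)
  have "\<theta> * real h = pi * k" using h by (simp add: \<theta>_def)
  then have s_antipode: "s (h + 1) = 0"
    by (simp add: s_def mult.commute)
  have period: "\<theta> * (2 * real h) = 2 * pi * k" using h by (simp add: \<theta>_def)
  have sin_period: "sin (\<theta> * (2 * real h) + x) = sin x" for x
  proof -
    have "sin (x + 2 * real k * pi) = sin x"
      by (simp add: sin_add sin_2npi)
    then show ?thesis
      by (simp only: period) (simp add: ac_simps)
  qed
  \<comment> \<open>Going once round the cycle adds \<open>2 * pi * k\<close> to the phase, so the
    wrap-around cases obey the same formulas as the interior ones.\<close>
  have s_succ: "s (if i = 2 * h then 1 else i + 1) = sin (\<theta> * real i)" for i
    using sin_period[of 0] by (auto simp: s_def)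
  have s_pred: "s (if i = 1 then 2 * h else i - 1) = sin (\<theta> * (real i - 2))" if "i \<ge> 1" for i
    using sin_period[of "- \<theta>"] that by (auto simp: s_def algebra_simps of_nat_diff)
  have rec: "sin (\<theta> * real i) + sin (\<theta> * (real i - 2)) = 2 * cos \<theta> * s i" for i
  proof -
    have "\<theta> * real i = \<theta> * (real i - 1) + \<theta>" "\<theta> * (real i - 2) = \<theta> * (real i - 1) - \<theta>"
      by (simp_all add: algebra_simps)
    then show ?thesis by (simp only: s_def sin_add sin_diff) simp
  qed
  \<comment> \<open>The bounds on \<open>k\<close> keep the wave from vanishing identically: its
    value at \<open>Cyc 2\<close> is \<open>sin \<theta>\<close>.\<close>
  have "0 < \<theta>" "\<theta> < pi"
    using k by (auto simp: \<theta>_def field_simps)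
  then have "f (Cyc 2) \<noteq> 0"
    using sin_gt_zero[of \<theta>] by (simp add: f_Cyc s_def)
  moreover have "Cyc 2 \<in> pverts ?G"
    using h by (simp add: S_graph_def)
  moreover have "(\<Sum>y | y \<in> pverts ?G \<and> (x, y) \<in> parcs ?G. f y) = l * f x"
    if x: "x \<in> pverts ?G" for x
  proof (cases x)
    case (Pend i j)
    then show ?thesis using neighbours_Pend[of i j h a] x l0 by (simp add: f_Cyc f_Pend)
  next
    case (Cyc i)
    then have i: "i \<in> {1..2 * h}" using x by (auto simp: S_graph_def)
    let ?p = "if i = 2 * h then 1 else i + 1" and ?m = "if i = 1 then 2 * h else i - 1"
    \<comment> \<open>For \<open>h = 1\<close> the two cycle neighbours would coincide and be summed
      only once.\<close>
    have "?p \<noteq> ?m" using h i by auto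
    then have "(\<Sum>y\<in>{Cyc ?p, Cyc ?m}. f y) = of_real (s ?p) + of_real (s ?m)"
      by (simp add: f_Cyc del: if_split)
    also have "\<dots> = of_real (2 * cos \<theta> * s i)"
      using i rec[of i] by (simp only: of_real_add[symmetric] s_succ s_pred atLeastAtMost_iff)
    finally have cycle: "(\<Sum>y\<in>{Cyc ?p, Cyc ?m}. f y) = of_real (2 * cos \<theta> * s i)" .
    have "(\<Sum>y\<in>Pend i ` {1..pendant_count h a i}. f y) =
        of_nat (pendant_count h a i) * (of_real (s i) / l)"
      by (subst sum.reindex) (auto simp: inj_on_def f_Pend)
    \<comment> \<open>The pendant count differs from \<open>a\<close> only at the two zeros of
      \<open>s\<close>, where both sides vanish.\<close>
    also have "\<dots> = of_nat a * (of_real (s i) / l)"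
      using s1 s_antipode by (auto simp: pendant_count_def)
    finally have pend: "(\<Sum>y\<in>Pend i ` {1..pendant_count h a i}. f y) =
        of_nat a * (of_real (s i) / l)" .
    have "(\<Sum>y | y \<in> pverts ?G \<and> (x, y) \<in> parcs ?G. f y) =
        (\<Sum>y\<in>{Cyc ?p, Cyc ?m}. f y) + (\<Sum>y\<in>Pend i ` {1..pendant_count h a i}. f y)"
      unfolding Cyc neighbours_Cyc[OF i] by (rule sum.union_disjoint) auto
    also have "\<dots> = (of_real (2 * cos \<theta>) * l + of_nat a) * of_real (s i) / l"
      unfolding cycle pend using l0 by (simp add: field_simps)
    also have "\<dots> = l * f x"
      using l0 unfolding Cyc f_Cyc \<theta>_def l[symmetric] by (simp add: power2_eq_square)
    finally show ?thesis .
  qed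
  ultimately show ?thesis
    unfolding eigenvalue_adjacency_matrix_iff[OF V] by blast
qed

text \<open>By Vieta, \<open>2 * cos (pi * k / h)\<close> is the sum of the two roots of the
  quadratic. Both are real because its discriminant is positive, and nonzero because their product
  is \<open>- a\<close>.\<close>

lemma integral_S_graph_imp_cos_Ints:
  fixes h k a :: nat
  assumes h: "h \<ge> 2" and a: "a \<ge> 1" and k: "0 < k" "k < h" and int: "integral_graph (S_graph h a)"
  shows "2 * cos (pi * k / h) \<in> \<int>"
proof -
  define t where "t = 2 * cos (pi * k / h)"
  define d where "d = sqrt (t\<^sup>2 + 4 * a)"
  from int obtain vs where vs: "distinct vs" "set vs = pverts (S_graph h a)"
    and ev: "\<And>l :: complex. eigenvalue (adjacency_matrix (S_graph h a) vs) l \<Longrightarrow> l \<in> \<int>"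
    unfolding integral_graph_def by blast
  have root: "x \<in> \<int>" if x: "x\<^sup>2 = t * x + a" for x :: real
  proof -
    have "x \<noteq> 0" using x a by auto
    moreover have "(of_real x :: complex)\<^sup>2 = of_real t * of_real x + of_nat a"
      using arg_cong[OF x, of complex_of_real] by simp
    ultimately have "(of_real x :: complex) \<in> \<int>"
      by (intro ev eigenvalue_S_graph[OF h k _ _ vs]) (auto simp: t_def)
    then show ?thesis by simp
  qed
  have "d\<^sup>2 = t\<^sup>2 + 4 * a" by (simp add: d_def)
  then have "(t + d) / 2 \<in> \<int>" "(t - d) / 2 \<in> \<int>"
    by (auto intro!: root simp: power2_eq_square field_simps)
  then have "(t + d) / 2 + (t - d) / 2 \<in> \<int>" by (rule Ints_add)
  then show ?thesis by (simp add: t_def field_simps)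
qed

theorem theorem3p11:
  fixes h a :: nat
  assumes "h \<ge> 2" and "a \<ge> 1" and "integral_graph (S_graph h a)"
  shows "h \<in> {2, 3}"
proof (rule ccontr)
  assume "h \<notin> {2, 3}"
  with assms(1) have h: "h \<ge> 4" by auto
  have "2 * cos (pi / h) \<in> \<int>"
    using integral_S_graph_imp_cos_Ints[of h a 1] assms by simp
  then obtain m :: int where m: "2 * cos (pi / h) = m" by (auto elim: Ints_cases)
  \<comment> \<open>The angle \<open>pi / 3\<close> is the one with
    \<open>2 * cos (pi / 3) = 1\<close>; \<open>h \<ge> 4\<close> puts \<open>pi / h\<close>
    strictly between 0 and it.\<close>
  have "cos (pi / 3) < cos (pi / h)"
    using h by (intro cos_monotone_0_pi) (auto simp: field_simps)
  moreover have "cos (pi / h) < cos 0"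
    using h by (intro cos_monotone_0_pi) (auto simp: field_simps)
  ultimately have "1 < m" "m < 2" using m by (simp_all add: cos_60)
  then show False by simp
qed

end
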